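(* Let $\mathcal{X}\subseteq\mathbb{R}^n\times\mathbb{R}^{m\times n}\times\mathbb{R}^m$ be a domain of LP problems. Suppose $\mathcal{X}$ is weakly solution-wise bounded for the primal and the solution correspondence $S$ is upper semicontinuous on $\mathcal{X}$. Then the optimal value function $V$ is continuous on $\mathcal{X}$.
   Context: Let $m,n$ be positive integers. An $m\times n$ LP problem is a triple $\xi=(p,A,b)\in\mathbb{R}^n\times\mathbb{R}^{m\times n}\times\mathbb{R}^m$, standing for: maximize $p^Tx$ subject to $Ax=b$, $x\ge 0$ (coordinatewise). Its feasible set is $X(\xi)=\{x\in\mathbb{R}^n_+ : Ax=b\}$ and its set of optimal solutions is $S(\xi)=\{x\in X(\xi): p^Tx\ge p^Tx' \text{ for all } x'\in X(\xi)\}$. A domain is a non-empty subset $\mathcal{X}$ of $\mathbb{R}^n\times\mathbb{R}^{m\times n}\times\mathbb{R}^m$ such that $S(\xi)\neq\emptyset$ for every $\xi\in\mathcal{X}$. The optimal value function $V:\mathcal{X}\to\mathbb{R}$ is $V(p,A,b)=p^Tx$ for any $x\in S(p,A,b)$. The solution correspondence on $\mathcal{X}$ is the set-valued map $\xi\mapsto S(\xi)$ from $\mathcal{X}$ to subsets of $\mathbb{R}^n_+$. Convergence of LP problems means convergence of each component $p$, $A$, $b$ in Euclidean norm; continuity of $V$ is with respect to this convergence within $\mathcal{X}$. $\mathcal{X}$ is weakly solution-wise bounded for the primal if there is a non-empty bounded subset $\Omega$ of $\mathbb{R}^n$ such that $\Omega\cap S(\xi)\neq\emptyset$ for all $\xi\in\mathcal{X}$.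 A correspondence (set-valued map) $F:\mathcal{X}\to\to Y$, $Y$ a subset of a Euclidean space, is upper semicontinuous at $\xi\in\mathcal{X}$ if for all sequences $\xi(N)\to\xi$ in $\mathcal{X}$ and $y(N)\to y$ in $Y$ with limit $y\in Y$, $y(N)\in F(\xi(N))$ for all $N\in\mathbb{N}$ implies $y\in F(\xi)$; it is upper semicontinuous on $\mathcal{X}$ if it is so at every $\xi\in\mathcal{X}$. *)

theory Defs
  imports "HOL-Analysis.Analysis"
begin

text \<open>
  The product topology on this type is componentwise convergence of \<open>p\<close>, \<open>A\<close>, \<open>b\<close>; the norm
  on \<open>real ^ 'n ^ 'm\<close> is the Euclidean norm of the matrix entries.
\<close>

type_synonym ('m, 'n) lp = "(real ^ 'n) \<times> (real ^ 'n ^ 'm) \<times> (real ^ 'm)"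

definition nonneg_orthant :: "(real ^ 'n) set" where
  "nonneg_orthant = {x. \<forall>i. 0 \<le> x $ i}"

definition feasible_set :: "('m::finite, 'n::finite) lp \<Rightarrow> (real ^ 'n) set" where
  "feasible_set = (\<lambda>(p, A, b). {x \<in> nonneg_orthant. A *v x = b})"

definition solution_set :: "('m::finite, 'n::finite) lp \<Rightarrow> (real ^ 'n) set" where
  "solution_set = (\<lambda>(p, A, b).
     {x \<in> feasible_set (p, A, b). \<forall>x' \<in> feasible_set (p, A, b). p \<bullet> x' \<le> p \<bullet> x})"

definition lp_domain :: "('m::finite, 'n::finite) lp set \<Rightarrow> bool" where
  "lp_domain X \<longleftrightarrow> X \<noteq> {} \<and> (\<forall>\<xi>\<in>X. solution_set \<xi> \<noteq> {})"

text \<open>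
  Total on all problems, but unspecified where there is no optimal solution; it is only meaningful
  on a domain.
\<close>

definition optimal_value :: "('m::finite, 'n::finite) lp \<Rightarrow> real" where
  "optimal_value = (\<lambda>(p, A, b). THE v. \<exists>x \<in> solution_set (p, A, b). v = p \<bullet> x)"

lemma optimal_value_eq:
  assumes "x \<in> solution_set (p, A, b)"
  shows "optimal_value (p, A, b) = p \<bullet> x"
  unfolding optimal_value_def prod.case
proof (rule the_equality)
  show "\<exists>y\<in>solution_set (p, A, b). p \<bullet> x = p \<bullet> y"
    using assms by blast
next
  fix v assume "\<exists>y\<in>solution_set (p, A, b). v = p \<bullet> y"
  then show "v = p \<bullet> x"
    using assms by (auto simp: solution_set_def intro: antisym)
qed

definition weakly_solution_wise_bounded_primal :: "('m::finite, 'n::finite) lp set \<Rightarrow> bool" where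
  "weakly_solution_wise_bounded_primal X \<longleftrightarrow>
     (\<exists>\<Omega>. \<Omega> \<noteq> {} \<and> bounded \<Omega> \<and> (\<forall>\<xi>\<in>X. \<Omega> \<inter> solution_set \<xi> \<noteq> {}))"

text \<open>
  Sequential upper semicontinuity (a closed-graph condition) of a correspondence \<open>F\<close> from \<open>X\<close> to
  \<open>Y\<close>. It is unrelated to upper semicontinuity of real-valued functions.
\<close>

definition upper_semicontinuous_at ::
  "'a::metric_space set \<Rightarrow> 'b::euclidean_space set \<Rightarrow> ('a \<Rightarrow> 'b set) \<Rightarrow> 'a \<Rightarrow> bool" where
  "upper_semicontinuous_at X Y F \<xi> \<longleftrightarrow>
     (\<forall>\<xi>s ys y. (\<forall>N::nat. \<xi>s N \<in> X) \<longrightarrow> \<xi>s \<longlonglongrightarrow> \<xi> \<longrightarrow>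
        (\<forall>N. ys N \<in> Y) \<longrightarrow> y \<in> Y \<longrightarrow> ys \<longlonglongrightarrow> y \<longrightarrow>
        (\<forall>N. ys N \<in> F (\<xi>s N)) \<longrightarrow> y \<in> F \<xi>)"

definition upper_semicontinuous_on ::
  "'a::metric_space set \<Rightarrow> 'b::euclidean_space set \<Rightarrow> ('a \<Rightarrow> 'b set) \<Rightarrow> bool" where
  "upper_semicontinuous_on X Y F \<longleftrightarrow> (\<forall>\<xi>\<in>X. upper_semicontinuous_at X Y F \<xi>)"

end

theory Submission
  imports Defs
begin

text \<open>
  Along a sequence of problems converging to \<open>\<xi>\<close> whose values stay away from the value at \<open>\<xi>\<close>,
  choose optimal solutions in the bounded set \<open>\<Omega>\<close>. A subsequence of them converges, by upper
  semicontinuity its limit is optimal for \<open>\<xi>\<close>, and continuity of the inner product then forces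
  the values along the subsequence to converge to the value at \<open>\<xi>\<close>.
\<close>

lemma closed_nonneg_orthant: "closed (nonneg_orthant :: (real ^ 'n) set)"
  unfolding nonneg_orthant_def
  by (intro closed_Collect_all closed_Collect_le continuous_intros)

lemma solution_set_subset_nonneg_orthant: "solution_set \<xi> \<subseteq> nonneg_orthant"
  by (cases \<xi>) (auto simp: solution_set_def feasible_set_def)

text \<open>Uses \<open>fst\<close> in place of a destructured triple, so that limits of values
  along a sequence of problems reduce to \<open>tendsto_fst\<close> and
  \<open>tendsto_inner\<close>.\<close>

lemma optimal_value_eq_inner_fst:
  "x \<in> solution_set \<xi> \<Longrightarrow> optimal_value \<xi> = fst \<xi> \<bullet> x"
  by (cases \<xi>) (simp add: optimal_value_eq)

theorem proposition8:
  fixes X :: "((real ^ 'n) \<times> (real ^ 'n ^ 'm) \<times> (real ^ 'm)) set"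
  assumes "lp_domain X"
    and "weakly_solution_wise_bounded_primal X"
    and "upper_semicontinuous_on X nonneg_orthant solution_set"
  shows "continuous_on X optimal_value"
proof (rule ccontr)
  assume "\<not> continuous_on X optimal_value"
  then obtain \<xi> e where \<xi>: "\<xi> \<in> X" and e: "e > 0"
    and far: "\<And>d. d > 0 \<Longrightarrow>
      \<exists>\<xi>'\<in>X. dist \<xi>' \<xi> < d \<and> \<not> dist (optimal_value \<xi>') (optimal_value \<xi>) < e"
    unfolding continuous_on_iff by blast
  have "\<forall>N. \<exists>\<xi>'\<in>X. dist \<xi>' \<xi> < inverse (real (Suc N)) \<and>
      \<not> dist (optimal_value \<xi>') (optimal_value \<xi>) < e"
    by (intro allI far) simp
  then obtain \<xi>s where \<xi>s: "\<And>N. \<xi>s N \<in> X"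
    and near: "\<And>N. dist (\<xi>s N) \<xi> < inverse (real (Suc N))"
    and away: "\<And>N. \<not> dist (optimal_value (\<xi>s N)) (optimal_value \<xi>) < e"
    by metis
  have "(\<lambda>N. dist (\<xi>s N) \<xi>) \<longlonglongrightarrow> 0"
    \<comment> \<open>\<open>of_nat_Suc\<close> is removed from the simpset so that the bound keeps
      the form in \<open>LIMSEQ_inverse_real_of_nat\<close>.\<close>
    by (rule tendsto_sandwich[OF _ _ tendsto_const LIMSEQ_inverse_real_of_nat])
      (use near in \<open>auto intro!: always_eventually less_imp_le simp del: of_nat_Suc\<close>)
  then have lim: "\<xi>s \<longlonglongrightarrow> \<xi>"
    by (rule tendsto_dist_iff[THEN iffD2])
  obtain \<Omega> where "bounded \<Omega>" and "\<And>\<zeta>. \<zeta> \<in> X \<Longrightarrow> \<Omega> \<inter> solution_set \<zeta> \<noteq> {}"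
    using assms(2) unfolding weakly_solution_wise_bounded_primal_def by blast
  with \<xi>s have "\<forall>N. \<exists>x. x \<in> \<Omega> \<and> x \<in> solution_set (\<xi>s N)" by blast
  then obtain x where x: "\<And>N. x N \<in> \<Omega>" "\<And>N. x N \<in> solution_set (\<xi>s N)" by metis
  have "bounded (range x)"
    using \<open>bounded \<Omega>\<close> by (rule bounded_subset) (use x(1) in blast)
  \<comment> \<open>Bolzano-Weierstrass; \<open>\<Omega>\<close> may fail to be closed, so
    \<open>y\<close> can lie outside it.\<close>
  then obtain y r where r: "strict_mono r" and y: "(x \<circ> r) \<longlonglongrightarrow> y"
    using bounded_imp_convergent_subsequence by blast
  have lim_r: "(\<xi>s \<circ> r) \<longlonglongrightarrow> \<xi>"
    using lim r by (rule LIMSEQ_subseq_LIMSEQ)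
  have x_nonneg: "(x \<circ> r) N \<in> nonneg_orthant" for N
    using subsetD[OF solution_set_subset_nonneg_orthant x(2)] by simp
  \<comment> \<open>Upper semicontinuity speaks only of limits inside \<open>nonneg_orthant\<close>,
    hence the appeal to closedness.\<close>
  have "y \<in> nonneg_orthant"
    using closed_nonneg_orthant x_nonneg y by (rule closed_sequentially)
  moreover have "upper_semicontinuous_at X nonneg_orthant solution_set \<xi>"
    using assms(3) \<xi> by (simp add: upper_semicontinuous_on_def)
  ultimately have "y \<in> solution_set \<xi>"
    unfolding upper_semicontinuous_at_def
    using \<xi>s x(2) x_nonneg lim_r y by (metis comp_apply)
  moreover have "(\<lambda>N. fst ((\<xi>s \<circ> r) N) \<bullet> (x \<circ> r) N) \<longlonglongrightarrow> fst \<xi> \<bullet> y"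
    by (intro tendsto_inner tendsto_fst lim_r y)
  \<comment> \<open>Optimality of each \<open>x (r N)\<close> turns the terms into optimal values;
    optimality of \<open>y\<close> does the same for the limit.\<close>
  ultimately have "(\<lambda>N. optimal_value (\<xi>s (r N))) \<longlonglongrightarrow> optimal_value \<xi>"
    by (simp add: optimal_value_eq_inner_fst optimal_value_eq_inner_fst[OF x(2)])
  then have "\<forall>\<^sub>F N in sequentially. dist (optimal_value (\<xi>s (r N))) (optimal_value \<xi>) < e"
    using e by (rule tendstoD)
  then show False
    using away by (simp add: eventually_False)
qed

end
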